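(* Let $\Bbbk$ be a field and let $(A,\prec,\succ,\cdot,\alpha,\beta)$ be a BiHom-tridendriform algebra over $\Bbbk$. Then $(A,\prec,\succ,\cdot,\alpha,\beta)$ is a BiHom-NS-algebra (with $\cdot$ playing the role of the operation $\vee$).
   Context: Everything is over a field $\Bbbk$; all maps are linear. A BiHom-tridendriform algebra $(A,\prec,\succ,\cdot,\alpha,\beta)$ is a linear space $A$ with linear maps $\prec,\succ,\cdot:A\otimes A\to A$ and $\alpha,\beta:A\to A$ such that $\alpha\circ\beta=\beta\circ\alpha$, both $\alpha$ and $\beta$ are multiplicative with respect to each of $\prec,\succ,\cdot$, and for all $x,y,z\in A$: $(x\prec y)\prec\beta(z)=\alpha(x)\prec(y\prec z+y\succ z+y\cdot z)$; $(x\succ y)\prec\beta(z)=\alpha(x)\succ(y\prec z)$; $\alpha(x)\succ(y\succ z)=(x\prec y+x\succ y+x\cdot y)\succ\beta(z)$; $\alpha(x)\cdot(y\succ z)=(x\prec y)\cdot\beta(z)$; $\alpha(x)\succ(y\cdot z)=(x\succ y)\cdot\beta(z)$; $\alpha(x)\cdot(y\prec z)=(x\cdot y)\prec\beta(z)$; $\alpha(x)\cdot(y\cdot z)=(x\cdot y)\cdot\beta(z)$. A BiHom-NS-algebra $(A,\prec,\succ,\vee,\alpha,\beta)$ is a linear space $A$ with linear maps $\prec,\succ,\vee:A\otimes A\to A$ and $\alpha,\beta:A\to A$ such that $\alpha\circ\beta=\beta\circ\alpha$, both $\alpha$ and $\beta$ are multiplicative with respect to each of $\prec,\succ,\vee$,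 and, writing $x\ast y=x\prec y+x\succ y+x\vee y$, for all $x,y,z\in A$: $(x\prec y)\prec\beta(z)=\alpha(x)\prec(y\ast z)$; $(x\succ y)\prec\beta(z)=\alpha(x)\succ(y\prec z)$; $(x\ast y)\succ\beta(z)=\alpha(x)\succ(y\succ z)$; $(x\vee y)\prec\beta(z)+(x\ast y)\vee\beta(z)=\alpha(x)\succ(y\vee z)+\alpha(x)\vee(y\ast z)$. *)

theory Defs
  imports Complex_Main
begin

text \<open>
  A linear space is a type of class \<open>ab_group_add\<close> with a scalar multiplication satisfying
  \<open>vector_space\<close>, and a linear map \<open>A \<otimes> A \<rightarrow> A\<close> is given by the corresponding bilinear map
  \<open>A \<times> A \<rightarrow> A\<close>, curried.
\<close>

definition bilinear_op ::
    "('k::field \<Rightarrow> 'a::ab_group_add \<Rightarrow> 'a) \<Rightarrow> ('a \<Rightarrow> 'a \<Rightarrow> 'a) \<Rightarrow> bool"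
  where "bilinear_op scale f \<longleftrightarrow>
    (\<forall>x. Vector_Spaces.linear scale scale (\<lambda>y. f x y)) \<and>
    (\<forall>y. Vector_Spaces.linear scale scale (\<lambda>x. f x y))"

definition multiplicative :: "('a \<Rightarrow> 'a \<Rightarrow> 'a) \<Rightarrow> ('a \<Rightarrow> 'a) \<Rightarrow> bool"
  where "multiplicative f \<phi> \<longleftrightarrow> (\<forall>x y. \<phi> (f x y) = f (\<phi> x) (\<phi> y))"

locale BiHom_three_operations = vector_space scale
  for scale :: "'k::field \<Rightarrow> 'a::ab_group_add \<Rightarrow> 'a" +
  fixes left :: "'a \<Rightarrow> 'a \<Rightarrow> 'a" (infixl "\<prec>" 70)
    and right :: "'a \<Rightarrow> 'a \<Rightarrow> 'a" (infixl "\<succ>" 70)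
    and mid :: "'a \<Rightarrow> 'a \<Rightarrow> 'a" (infixl "\<bullet>" 70)
    and \<alpha> :: "'a \<Rightarrow> 'a"
    and \<beta> :: "'a \<Rightarrow> 'a"
  assumes bilinear_left: "bilinear_op scale (\<prec>)"
    and bilinear_right: "bilinear_op scale (\<succ>)"
    and bilinear_mid: "bilinear_op scale (\<bullet>)"
    and linear_alpha: "Vector_Spaces.linear scale scale \<alpha>"
    and linear_beta: "Vector_Spaces.linear scale scale \<beta>"
    and alpha_beta_commute: "\<alpha> \<circ> \<beta> = \<beta> \<circ> \<alpha>"
    and alpha_left: "multiplicative (\<prec>) \<alpha>"
    and alpha_right: "multiplicative (\<succ>) \<alpha>"
    and alpha_mid: "multiplicative (\<bullet>) \<alpha>"
    and beta_left: "multiplicative (\<prec>) \<beta>"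
    and beta_right: "multiplicative (\<succ>) \<beta>"
    and beta_mid: "multiplicative (\<bullet>) \<beta>"

definition (in BiHom_three_operations) star :: "'a \<Rightarrow> 'a \<Rightarrow> 'a" (infixl "\<star>" 70)
  where "x \<star> y = x \<prec> y + x \<succ> y + x \<bullet> y"

locale BiHom_tridendriform_algebra = BiHom_three_operations +
  assumes left_left: "(x \<prec> y) \<prec> \<beta> z = \<alpha> x \<prec> (y \<prec> z + y \<succ> z + y \<bullet> z)"
    and right_left: "(x \<succ> y) \<prec> \<beta> z = \<alpha> x \<succ> (y \<prec> z)"
    and right_right: "\<alpha> x \<succ> (y \<succ> z) = (x \<prec> y + x \<succ> y + x \<bullet> y) \<succ> \<beta> z"
    and dot_right: "\<alpha> x \<bullet> (y \<succ> z) = (x \<prec> y) \<bullet> \<beta> z"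
    and right_dot: "\<alpha> x \<succ> (y \<bullet> z) = (x \<succ> y) \<bullet> \<beta> z"
    and dot_left: "\<alpha> x \<bullet> (y \<prec> z) = (x \<bullet> y) \<prec> \<beta> z"
    and dot_dot: "\<alpha> x \<bullet> (y \<bullet> z) = (x \<bullet> y) \<bullet> \<beta> z"

text \<open>The operation usually written \<open>\<or>\<close> in an NS-algebra is \<open>\<bullet>\<close> here, so that both structures share one signature.\<close>

locale BiHom_NS_algebra = BiHom_three_operations +
  assumes left_left: "(x \<prec> y) \<prec> \<beta> z = \<alpha> x \<prec> (y \<star> z)"
    and right_left: "(x \<succ> y) \<prec> \<beta> z = \<alpha> x \<succ> (y \<prec> z)"
    and right_right: "(x \<star> y) \<succ> \<beta> z = \<alpha> x \<succ> (y \<succ> z)"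
    and vee_sum: "(x \<bullet> y) \<prec> \<beta> z + (x \<star> y) \<bullet> \<beta> z = \<alpha> x \<succ> (y \<bullet> z) + \<alpha> x \<bullet> (y \<star> z)"

end

theory Submission
  imports Defs
begin

text \<open>
  Only the last NS axiom needs an argument: by bilinearity its two sides expand into four terms
  each, and these agree in pairs by the four tridendriform axioms that involve the middle operation.
\<close>

lemma bilinear_op_add_left:
  assumes "bilinear_op scale f"
  shows "f (x + y) z = f x z + f y z"
proof -
  interpret Vector_Spaces.linear scale scale "\<lambda>x. f x z"
    using assms by (simp add: bilinear_op_def)
  show ?thesis by (rule add)
qed

lemma bilinear_op_add_right:
  assumes "bilinear_op scale f"
  shows "f x (y + z) = f x y + f x z"
proof -
  interpret Vector_Spaces.linear scale scale "f x"
    using assms by (simp add: bilinear_op_def)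
  show ?thesis by (rule add)
qed

theorem proposition2p4:
  fixes scale :: "'k::field \<Rightarrow> 'a::ab_group_add \<Rightarrow> 'a"
    and left right dot :: "'a \<Rightarrow> 'a \<Rightarrow> 'a"
    and \<alpha> \<beta> :: "'a \<Rightarrow> 'a"
  assumes "BiHom_tridendriform_algebra scale left right dot \<alpha> \<beta>"
  shows "BiHom_NS_algebra scale left right dot \<alpha> \<beta>"
proof -
  interpret BiHom_tridendriform_algebra scale left right dot \<alpha> \<beta>
    by (rule assms)
  show ?thesis
  \<comment> \<open>Both structures extend \<open>BiHom_three_operations\<close>, which the
    interpretation already supplies, so only the four NS axioms remain.\<close>
  proof unfold_locales
    fix x y z
    show "left (left x y) (\<beta> z) = left (\<alpha> x) (star y z)"
      by (simp add: star_def left_left)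
    show "left (right x y) (\<beta> z) = right (\<alpha> x) (left y z)"
      by (rule right_left)
    show "right (star x y) (\<beta> z) = right (\<alpha> x) (right y z)"
      by (simp add: star_def right_right)
    \<comment> \<open>The axioms \<open>dot_right\<close>, \<open>right_dot\<close>,
      \<open>dot_left\<close> and \<open>dot_dot\<close> turn every term on the right into one with
      \<open>\<beta> z\<close> as outer right factor. The pairs cross between the summands:
      \<open>right_dot\<close> reaches into \<open>dot (star x y) (\<beta> z)\<close>,
      \<open>dot_left\<close> yields the lone first term; hence \<open>ac_simps\<close>.\<close>
    show "left (dot x y) (\<beta> z) + dot (star x y) (\<beta> z)
        = right (\<alpha> x) (dot y z) + dot (\<alpha> x) (star y z)"
      by (simp add: star_def bilinear_op_add_left[OF bilinear_mid]
          bilinear_op_add_right[OF bilinear_mid] dot_right right_dot dot_left dot_dot ac_simps)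
  qed
qed

end
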